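(* Let $p\ge1$ be an integer and let $H_{\Gamma_n^p}(x)=\sum_{k\geq 0}h_k(\Gamma_n^p)x^k$ denote the enumerator polynomial of the maximal hypercubes in $\Gamma_n^p$, where $h_k(\Gamma_n^p)$ is the number of maximal hypercubes of dimension $k$ in $\Gamma_n^p$. Then $$H_{\Gamma_n^p}(x) = x\sum_{i=1}^{p+1}H_{\Gamma_{n-p-i}^p}(x) \quad \text{for } n\geq2p+1,$$ with $H_{\Gamma_0^p}(x) =1$, $H_{\Gamma_n^p}(x) =nx$ for $1\le n\le p+1$, and $H_{\Gamma_n^p}(x) =\frac{(n-p-1)(n-p)}{2}x^2+(2p-n+2)x$ for $p+2\le n\le 2p$. The generating function of the sequence $(H_{\Gamma_n^p}(x))_{n\geq 0}$ is, as a formal power series in $t$, $$\sum_{n \ge 0}H_{\Gamma_n^p}(x)t^n=\frac{1+xt(1+t+t^2+\dots+t^p)(1+t+t^2+\dots+t^{p-1})}{1-xt^{p+1}(1+t+t^2+\dots+t^p)}.$$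
   Context: For an integer $n\ge 0$, the hypercube $Q_n$ has vertex set $\{0,1\}^n$ (binary strings of length $n$; for $n=0$ only the empty string), two strings being adjacent iff they differ in exactly one coordinate. For $p\ge1$, a Fibonacci $p$-string is a binary string in which any two consecutive 1s (i.e. successive occurrences of 1) are separated by at least $p$ 0s. The Fibonacci $p$-cube $\Gamma_n^p$ is the subgraph of $Q_n$ induced by the Fibonacci $p$-strings of length $n$; in particular $\Gamma_0^p=K_1$. A maximal hypercube of dimension $k$ of a graph $G$ is an induced subgraph $H$ of $G$ isomorphic to $Q_k$ that is not contained in a larger induced subgraph of $G$ isomorphic to a hypercube. *)

theory Defs
  imports
    "HOL-Computational_Algebra.Computational_Algebra"
    "Graph_Theory.Graph_Theory"
begin

text \<open>
  Undirected graphs are represented, as in the session Graph_Theory, by symmetric digraphs: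
  an edge \<open>uv\<close> is the pair of arcs \<open>(u, v)\<close> and \<open>(v, u)\<close>.
  Binary strings are boolean lists, with \<^const>\<open>True\<close> for the symbol 1.
\<close>

definition hypercube :: "nat \<Rightarrow> (bool list, bool list \<times> bool list) pre_digraph" where
  "hypercube n = with_proj
     \<lparr>pverts = {w. length w = n},
      parcs = {(u, v). length u = n \<and> length v = n \<and> card {i. i < n \<and> u ! i \<noteq> v ! i} = 1}\<rparr>"

text \<open>Positions \<open>i < j\<close> carry successive occurrences of 1; the \<open>j - i - 1\<close> symbols between are 0s.\<close>

definition fibonacci_string :: "nat \<Rightarrow> bool list \<Rightarrow> bool" where
  "fibonacci_string p w \<longleftrightarrow>
     (\<forall>i j. i < j \<and> j < length w \<and> w ! i \<and> w ! j \<and> (\<forall>k. i < k \<and> k < j \<longrightarrow> \<not> w ! k)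
        \<longrightarrow> p \<le> j - i - 1)"

definition fibonacci_cube :: "nat \<Rightarrow> nat \<Rightarrow> (bool list, bool list \<times> bool list) pre_digraph" where
  "fibonacci_cube p n = hypercube n \<restriction> {w. length w = n \<and> fibonacci_string p w}"

definition maximal_hypercube :: "('a, 'b) pre_digraph \<Rightarrow> nat \<Rightarrow> ('a, 'b) pre_digraph \<Rightarrow> bool" where
  "maximal_hypercube G k H \<longleftrightarrow>
     induced_subgraph H G \<and> digraph_iso (hypercube k) H \<and>
     \<not> (\<exists>H' m. induced_subgraph H' G \<and> digraph_iso (hypercube m) H' \<and> subgraph H H' \<and> H \<noteq> H')"

definition num_maximal_hypercubes :: "('a, 'b) pre_digraph \<Rightarrow> nat \<Rightarrow> nat" where
  "num_maximal_hypercubes G k = card {H. maximal_hypercube G k H}"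

text \<open>
  The sum over all \<open>k\<close> is restricted to its nonzero terms, which are finitely many for a
  finite \<open>G\<close>. Coefficients are rational so that the closed forms can be divided by 2.
\<close>

definition maximal_hypercube_poly :: "('a, 'b) pre_digraph \<Rightarrow> rat poly" where
  "maximal_hypercube_poly G =
     (\<Sum>k | num_maximal_hypercubes G k \<noteq> 0. monom (of_nat (num_maximal_hypercubes G k)) k)"

lemma arcs_ends_hypercube:
  "arcs_ends (hypercube n) =
     {(u, v). length u = n \<and> length v = n \<and> card {i. i < n \<and> u ! i \<noteq> v ! i} = 1}"
  by (simp add: hypercube_def arcs_ends_conv case_prod_unfold)

lemma graph_hypercube: "graph (hypercube n)"
proof -
  let ?V = "{w :: bool list. length w = n}"
  have fin: "finite ?V"
    using finite_lists_length_eq[of "UNIV :: bool set" n] by simp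
  have "finite (arcs (hypercube n))"
    by (rule finite_subset[OF _ finite_cartesian_product[OF fin fin]])
      (auto simp: hypercube_def)
  moreover have "sym (arcs_ends (hypercube n))"
  proof (rule symI)
    fix u v assume "(u, v) \<in> arcs_ends (hypercube n)"
    moreover have "{i. i < n \<and> v ! i \<noteq> u ! i} = {i. i < n \<and> u ! i \<noteq> v ! i}"
      by blast
    ultimately show "(v, u) \<in> arcs_ends (hypercube n)"
      unfolding arcs_ends_hypercube by (simp only: mem_Collect_eq prod.case conj_commute)
  qed
  moreover have "finite (verts (hypercube n))"
    using fin by (simp add: hypercube_def)
  ultimately show ?thesis
    unfolding symmetric_def[symmetric]
    by unfold_locales (assumption | fastforce simp: hypercube_def arc_to_ends_def)+
qed

lemma induced_subgraph_fibonacci_cube: "induced_subgraph (fibonacci_cube p n) (hypercube n)"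
proof -
  interpret graph "hypercube n" by (rule graph_hypercube)
  show ?thesis
    unfolding fibonacci_cube_def by (rule induced_induce) (auto simp: hypercube_def)
qed

end

theory Submission
  imports Defs
begin

text \<open>
  Identify a binary string with the set of positions of its 1s, so that adjacency in \<open>Q\<^sub>n\<close> means
  that the symmetric difference is a singleton. The Fibonacci strings become the gapped sets,
  those whose distinct elements are more than \<open>p\<close> apart, and these are closed under taking
  subsets.

  Every copy of \<open>Q\<^sub>k\<close> in \<open>Q\<^sub>n\<close> consists of the symmetric differences of a fixed set \<open>B\<close> with the subsets
  of a fixed \<open>k\<close>-element set \<open>D\<close> (\<open>hypercube_subgraph_verts\<close>). If it lies in the Fibonacci cube then
  its top \<open>B \<union> D\<close> is gapped, hence so are all subsets of \<open>B \<union> D\<close>, and these form a hypercube that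
  contains the given one. Therefore the maximal hypercubes of dimension \<open>k\<close> are the families of
  all subsets of the \<open>k\<close>-element maximal gapped sets (\<open>maximal_hypercubes_fibonacci_cube\<close>), and the
  enumerator polynomial is the sum of \<open>x\<close> to the power \<open>card A\<close> over the maximal gapped sets \<open>A\<close>.

  A gapped set is maximal iff every position is at distance at most \<open>p\<close> from an element. The first
  1 of a maximal string of length \<open>n \<ge> 1\<close> is thus at a position \<open>a \<le> p\<close>, and cutting off this 1
  together with the \<open>a\<close> symbols before and the \<open>p\<close> symbols after it leaves an arbitrary maximal
  string of length \<open>n - (a + p + 1)\<close>, where negative lengths count as 0. This gives
  \<open>H n = x * (\<Sum>a | a < n \<and> a \<le> p. H (n - (a + p + 1)))\<close> for all \<open>n \<ge> 1\<close>
  (\<open>maximal_hypercube_poly_fibonacci_cube_rec\<close>), and with \<open>H 0 = 1\<close> all claims follow. For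
  \<open>n \<ge> 2 * p + 1\<close> no subtraction is truncated; for \<open>1 \<le> n \<le> p + 1\<close> all \<open>n\<close> terms are \<open>H 0\<close>; for
  \<open>n\<close> in between, the terms are known from the previous case; and the truncated terms make up the
  numerator of the generating function (\<open>fps_eq_of_recurrence\<close>).
\<close>

section \<open>Binary strings as sets of positions\<close>

definition ones :: "bool list \<Rightarrow> nat set" where
  "ones w = {i. i < length w \<and> w ! i}"

definition string_of :: "nat \<Rightarrow> nat set \<Rightarrow> bool list" where
  "string_of n A = map (\<lambda>i. i \<in> A) [0..<n]"

text \<open>
  The condition is imposed on all pairs of 1s, not only on successive ones. This is equivalent
  and makes heredity under removal of 1s immediate.
\<close>
definition gapped :: "nat \<Rightarrow> nat set \<Rightarrow> bool" where
  "gapped p A \<longleftrightarrow> (\<forall>i\<in>A. \<forall>j\<in>A. i < j \<longrightarrow> i + p < j)"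

definition gapped_sets :: "nat \<Rightarrow> nat \<Rightarrow> nat set set" where
  "gapped_sets p n = {A. A \<subseteq> {..<n} \<and> gapped p A}"

definition maximal_gapped_sets :: "nat \<Rightarrow> nat \<Rightarrow> nat set set" where
  "maximal_gapped_sets p n =
     {A \<in> gapped_sets p n. \<forall>A' \<in> gapped_sets p n. A \<subseteq> A' \<longrightarrow> A = A'}"

lemma length_string_of [simp]: "length (string_of n A) = n"
  by (simp add: string_of_def)

lemma ones_string_of [simp]: "ones (string_of n A) = A \<inter> {..<n}"
  by (auto simp: ones_def string_of_def)

lemma string_of_ones [simp]: "length w = n \<Longrightarrow> string_of n (ones w) = w"
  by (auto simp: ones_def string_of_def intro: nth_equalityI)

lemma ones_subset: "length w = n \<Longrightarrow> ones w \<subseteq> {..<n}"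
  by (auto simp: ones_def)

lemma ones_inject: "length u = length v \<Longrightarrow> ones u = ones v \<longleftrightarrow> u = v"
  by (metis string_of_ones)

lemma gapped_subset: "gapped p A \<Longrightarrow> A' \<subseteq> A \<Longrightarrow> gapped p A'"
  unfolding gapped_def by blast

text \<open>
  For two arbitrary 1s, the bound on the distance is inherited from the first of them and the
  1 that follows it.
\<close>
lemma fibonacci_string_iff_gapped: "fibonacci_string p w \<longleftrightarrow> gapped p (ones w)"
proof
  assume fib: "fibonacci_string p w"
  show "gapped p (ones w)"
    unfolding gapped_def
  proof (intro ballI impI)
    fix i j assume ij: "i \<in> ones w" "j \<in> ones w" "i < j"
    define m where "m = (LEAST m. m \<in> ones w \<and> i < m)"
    have m: "m \<in> ones w \<and> i < m"
      unfolding m_def by (rule LeastI[of _ j]) (use ij in blast)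
    have "m \<le> j"
      unfolding m_def by (rule Least_le) (use ij in blast)
    moreover have "\<not> w ! k" if "i < k" "k < m" for k
      using not_less_Least[of k "\<lambda>m. m \<in> ones w \<and> i < m"] that m
      unfolding m_def[symmetric] by (simp add: ones_def)
    ultimately have "p \<le> m - i - 1"
      using fib m ij unfolding fibonacci_string_def by (auto simp: ones_def)
    then show "i + p < j"
      using m \<open>m \<le> j\<close> by linarith
  qed
next
  assume "gapped p (ones w)"
  then show "fibonacci_string p w"
    unfolding fibonacci_string_def gapped_def ones_def by fastforce
qed

section \<open>Hypercubes inside a hypercube\<close>

lemma verts_hypercube [simp]: "verts (hypercube n) = {w. length w = n}"
  by (simp add: hypercube_def)

lemma tail_hypercube [simp]: "tail (hypercube n) = fst"
  and head_hypercube [simp]: "head (hypercube n) = snd"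
  by (simp_all add: hypercube_def)

lemma arcs_hypercube:
  "(u, v) \<in> arcs (hypercube n) \<longleftrightarrow>
     length u = n \<and> length v = n \<and> (\<exists>a. ones v = sym_diff (ones u) {a})"
proof -
  have "card {i. i < n \<and> u ! i \<noteq> v ! i} = 1 \<longleftrightarrow> (\<exists>a. ones v = sym_diff (ones u) {a})"
    if "length u = n" "length v = n"
  proof -
    have "{i. i < n \<and> u ! i \<noteq> v ! i} = sym_diff (ones u) (ones v)"
      using that by (auto simp: ones_def)
    moreover have "sym_diff (ones u) (ones v) = {a} \<longleftrightarrow> ones v = sym_diff (ones u) {a}" for a
      by blast
    ultimately show ?thesis
      by (simp add: card_1_singleton_iff)
  qed
  then show ?thesis
    by (auto simp: hypercube_def)
qed

lemma sym_diff_insert: "a \<notin> U \<Longrightarrow> sym_diff F (insert a U) = sym_diff (sym_diff F U) {a}"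
  by auto

text \<open>
  A cube map that sends edges to edges flips one coordinate \<open>\<delta> i\<close> for each coordinate \<open>i\<close>, the same
  one wherever \<open>i\<close> is flipped. Indeed the opposite corner \<open>f (T \<union> {i, j})\<close> of the square at
  \<open>f T\<close> is adjacent to both neighbours \<open>f T\<close> xor \<open>{\<delta> i}\<close> and \<open>f T\<close> xor \<open>{\<delta> j}\<close> of \<open>f T\<close>. The
  only such vertices are \<open>f T\<close> itself, which injectivity excludes, and \<open>f T\<close> xor
  \<open>{\<delta> i, \<delta> j}\<close>.
\<close>
lemma cube_embedding_affine:
  fixes f :: "'a set \<Rightarrow> 'b set"
  assumes fin: "finite K" and inj: "inj_on f (Pow K)"
    and step: "\<And>S i. S \<subseteq> K \<Longrightarrow> i \<in> K \<Longrightarrow> i \<notin> S \<Longrightarrow> \<exists>a. f (insert i S) = sym_diff (f S) {a}"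
  obtains \<delta> where "inj_on \<delta> K" "\<And>S. S \<subseteq> K \<Longrightarrow> f S = sym_diff (f {}) (\<delta> ` S)"
proof -
  have "\<forall>i\<in>K. \<exists>a. f {i} = sym_diff (f {}) {a}"
    using step[of "{}"] by simp
  then obtain \<delta> where \<delta>: "\<And>i. i \<in> K \<Longrightarrow> f {i} = sym_diff (f {}) {\<delta> i}"
    by metis
  have inj\<delta>: "inj_on \<delta> K"
  proof (rule inj_onI)
    fix i j assume ij: "i \<in> K" "j \<in> K" "\<delta> i = \<delta> j"
    then have "f {i} = f {j}"
      using \<delta> by simp
    then have "{i} = {j}"
      using inj ij by (auto dest: inj_onD)
    then show "i = j" by simp
  qed
  have "f S = sym_diff (f {}) (\<delta> ` S)" if "S \<subseteq> K" for S
    using finite_subset[OF that fin] that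
  proof (induction S rule: finite_psubset_induct)
    case (psubset S)
    show ?case
    proof (cases "\<exists>i j. i \<in> S \<and> j \<in> S \<and> i \<noteq> j")
      case False
      then have "S = {} \<or> (\<exists>i. S = {i})"
        by blast
      then show ?thesis
        using \<delta> psubset.prems by auto
    next
      case True
      then obtain i j where ij: "i \<in> S" "j \<in> S" "i \<noteq> j" by blast
      define T where "T = S - {i, j}"
      have S: "S = insert i (insert j T)" "S = insert j (insert i T)"
        and T: "i \<notin> T" "j \<notin> T" "T \<subseteq> K" "i \<in> K" "j \<in> K"
        using ij psubset.prems by (auto simp: T_def)
      have fresh: "\<delta> i \<notin> \<delta> ` T" "\<delta> j \<notin> \<delta> ` T" "\<delta> i \<noteq> \<delta> j"
        using inj\<delta> T ij(3) by (auto dest: inj_onD)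
      have "T \<subset> S" "insert i T \<subset> S" "insert j T \<subset> S"
        using S T ij by auto
      note IH = this[THEN psubset.IH]
      have fT: "f T = sym_diff (f {}) (\<delta> ` T)"
        and fi: "f (insert i T) = sym_diff (f {}) (\<delta> ` insert i T)"
        and fj: "f (insert j T) = sym_diff (f {}) (\<delta> ` insert j T)"
        using IH T by auto
      have fi': "f (insert i T) = sym_diff (f T) {\<delta> i}"
        unfolding fi fT image_insert using fresh(1) by (rule sym_diff_insert)
      have fj': "f (insert j T) = sym_diff (f T) {\<delta> j}"
        unfolding fj fT image_insert using fresh(2) by (rule sym_diff_insert)
      obtain a where a: "f S = sym_diff (f (insert j T)) {a}"
        using step[of "insert j T" i] T ij S by auto
      obtain b where b: "f S = sym_diff (f (insert i T)) {b}"
        using step[of "insert i T" j] T ij S by auto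
      have ne: "f S \<noteq> f T"
        using inj psubset.prems T S by (metis PowI inj_onD insertI1)
      \<comment> \<open>The routes from \<open>T\<close> to \<open>S\<close> through \<open>insert j T\<close> and \<open>insert i T\<close> flip the same
        coordinates, so \<open>{\<delta> j, a} = {\<delta> i, b}\<close>.\<close>
      have "a = \<delta> i"
      proof (rule ccontr)
        assume "a \<noteq> \<delta> i"
        have "a \<noteq> \<delta> j"
          using a fj' ne by auto
        have "(\<delta> i \<in> f S) = (\<delta> i \<in> f T)"
          using a fj' fresh(3) \<open>a \<noteq> \<delta> i\<close> by auto
        then have "b = \<delta> i"
          using b fi' by auto
        then have "f S = f T"
          using b fi' by auto
        then show False using ne by simp
      qed
      then have "f S = sym_diff (sym_diff (f {}) (\<delta> ` insert j T)) {\<delta> i}"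
        using a fj by simp
      also have "\<dots> = sym_diff (f {}) (insert (\<delta> i) (\<delta> ` insert j T))"
        by (rule sym_diff_insert[symmetric]) (use fresh in auto)
      finally show ?thesis
        by (simp add: S(1))
    qed
  qed
  then show ?thesis
    using that inj\<delta> by blast
qed

text \<open>
  The rigidity of edge-preserving cube maps in terms of graphs: a copy of \<open>Q\<^sub>k\<close> in \<open>Q\<^sub>n\<close> is the
  set of all strings that agree with a fixed string \<open>B\<close> outside a set \<open>D\<close> of \<open>k\<close> coordinates.
\<close>
lemma hypercube_subgraph_verts:
  assumes iso: "digraph_iso (hypercube k) H" and sub: "subgraph H (hypercube n)"
  obtains B D where "B \<subseteq> {..<n}" "D \<subseteq> {..<n}" "card D = k"
    "ones ` verts H = sym_diff B ` Pow D"
proof -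
  obtain h where h: "pre_digraph.digraph_isomorphism (hypercube k) h" "H = app_iso h (hypercube k)"
    using iso unfolding digraph_iso_def by blast
  define f where "f S = ones (iso_verts h (string_of k S))" for S
  have len: "length (iso_verts h w) = n" if "length w = k" for w
    using sub h(2) that by (auto simp: subgraph_def)
  have inj_on_h: "inj_on (iso_verts h) {w. length w = k}"
    using h(1) by (simp add: pre_digraph.digraph_isomorphism_def)
  have inj: "inj_on f (Pow {..<k})"
  proof (rule inj_onI)
    fix S T assume ST: "S \<in> Pow {..<k}" "T \<in> Pow {..<k}" "f S = f T"
    then have "iso_verts h (string_of k S) = iso_verts h (string_of k T)"
      unfolding f_def by (subst (asm) ones_inject) (simp_all add: len)
    then have "string_of k S = string_of k T"
      using inj_on_h by (auto dest: inj_onD)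
    then have "ones (string_of k S) = ones (string_of k T)"
      by simp
    then show "S = T"
      using ST by auto
  qed
  have step: "\<exists>a. f (insert i S) = sym_diff (f S) {a}"
    if Si: "S \<subseteq> {..<k}" "i \<in> {..<k}" "i \<notin> S" for S i
  proof -
    let ?e = "(string_of k S, string_of k (insert i S))"
    have "insert i S \<inter> {..<k} = sym_diff (S \<inter> {..<k}) {i}"
      using Si by auto
    then have e: "?e \<in> arcs (hypercube k)"
      unfolding arcs_hypercube by auto
    let ?e' = "iso_arcs h ?e"
    have "?e' \<in> arcs H"
      using e h(2) by simp
    then have "?e' \<in> arcs (hypercube n)"
      using sub by (auto simp: subgraph_def)
    moreover have "fst ?e' = tail H ?e'" "snd ?e' = head H ?e'"
      using sub by (simp_all add: subgraph_def compatible_def)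
    moreover have "tail H ?e' = iso_verts h (string_of k S)"
      "head H ?e' = iso_verts h (string_of k (insert i S))"
      using h e by (auto simp: pre_digraph.digraph_isomorphism_def)
    ultimately have "(iso_verts h (string_of k S), iso_verts h (string_of k (insert i S)))
        \<in> arcs (hypercube n)"
      by (metis prod.collapse)
    then show ?thesis
      unfolding arcs_hypercube f_def by blast
  qed
  obtain \<delta> where \<delta>: "inj_on \<delta> {..<k}" "\<And>S. S \<subseteq> {..<k} \<Longrightarrow> f S = sym_diff (f {}) (\<delta> ` S)"
    using cube_embedding_affine[of "{..<k}" f, OF _ inj] step by blast
  have f_sub: "f S \<subseteq> {..<n}" for S
    unfolding f_def by (rule ones_subset) (simp add: len)
  have "{w. length w = k} = string_of k ` Pow {..<k}"
  proof -
    have "w \<in> string_of k ` Pow {..<k}" if "length w = k" for w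
      using string_of_ones[OF that] ones_subset[OF that] by (metis PowI imageI)
    then show ?thesis by auto
  qed
  then have "ones ` verts H = f ` Pow {..<k}"
    by (simp add: h(2) f_def image_image)
  also have "\<dots> = (\<lambda>S. sym_diff (f {}) (\<delta> ` S)) ` Pow {..<k}"
    by (rule image_cong[OF refl \<delta>(2)]) simp
  also have "\<dots> = sym_diff (f {}) ` Pow (\<delta> ` {..<k})"
    by (simp add: image_Pow_surj[OF refl, symmetric] image_image)
  finally have "ones ` verts H = sym_diff (f {}) ` Pow (\<delta> ` {..<k})" .
  moreover have "\<delta> ` {..<k} \<subseteq> {..<n}"
  proof -
    have "\<delta> ` {..<k} \<subseteq> f {} \<union> f {..<k}"
      unfolding \<delta>(2)[of "{..<k}", OF subset_refl] by blast
    then show ?thesis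
      using f_sub[of "{}"] f_sub[of "{..<k}"] by (meson Un_least subset_trans)
  qed
  moreover have "card (\<delta> ` {..<k}) = k"
    using card_image[OF \<delta>(1)] by simp
  ultimately show ?thesis
    using that[OF f_sub] by simp
qed

section \<open>Maximal hypercubes of a Fibonacci cube\<close>

lemma verts_fibonacci_cube: "verts (fibonacci_cube p n) = {w. length w = n \<and> gapped p (ones w)}"
  by (simp add: fibonacci_cube_def fibonacci_string_iff_gapped)

lemma arcs_fibonacci_cube:
  "(u, v) \<in> arcs (fibonacci_cube p n) \<longleftrightarrow>
     length u = n \<and> length v = n \<and> gapped p (ones u) \<and> gapped p (ones v) \<and>
     (\<exists>a. ones v = sym_diff (ones u) {a})"
  by (auto simp: fibonacci_cube_def fibonacci_string_iff_gapped arcs_hypercube)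

lemma tail_fibonacci_cube [simp]: "tail (fibonacci_cube p n) = fst"
  and head_fibonacci_cube [simp]: "head (fibonacci_cube p n) = snd"
  by (simp_all add: fibonacci_cube_def)

lemma wf_digraph_fibonacci_cube: "wf_digraph (fibonacci_cube p n)"
  using induced_subgraph_fibonacci_cube by (rule wf_digraphI_induced)

definition lower_cube :: "nat \<Rightarrow> nat \<Rightarrow> nat set \<Rightarrow> (bool list, bool list \<times> bool list) pre_digraph" where
  "lower_cube p n A = fibonacci_cube p n \<restriction> {w. length w = n \<and> ones w \<subseteq> A}"

lemma verts_lower_cube [simp]: "verts (lower_cube p n A) = {w. length w = n \<and> ones w \<subseteq> A}"
  by (simp add: lower_cube_def)

lemma induced_subgraph_lower_cube:
  assumes "gapped p A"
  shows "induced_subgraph (lower_cube p n A) (fibonacci_cube p n)"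
  unfolding lower_cube_def
  by (rule wf_digraph.induced_induce[OF wf_digraph_fibonacci_cube])
    (use assms in \<open>auto simp: verts_fibonacci_cube intro: gapped_subset\<close>)

text \<open>
  A bijection from \<open>{..<card A}\<close> to \<open>A\<close> moves the coordinates of the small cube to those in \<open>A\<close>;
  all other coordinates are filled with 0.
\<close>
lemma digraph_iso_lower_cube:
  assumes A: "A \<in> gapped_sets p n"
  shows "digraph_iso (hypercube (card A)) (lower_cube p n A)"
proof -
  have fin: "finite A" and sub: "A \<subseteq> {..<n}" and gap: "gapped p A"
    using A finite_subset by (auto simp: gapped_sets_def)
  define k where "k = card A"
  obtain e where e: "bij_betw e {..<k} A"
    using ex_bij_betw_nat_finite[OF fin] unfolding k_def atLeast0LessThan by blast
  define f where "f w = string_of n (e ` ones w)" for w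
  have ones_f: "ones (f w) = e ` ones w" and e_ones: "e ` ones w \<subseteq> A" if "length w = k" for w
    using ones_subset[OF that] e sub unfolding f_def by (auto simp: bij_betw_def)
  have len_f [simp]: "length (f w) = n" for w
    by (simp add: f_def)
  have ones_f_subset: "ones (f w) \<subseteq> A" if "length w = k" for w
    using ones_f e_ones that by simp
  have inj_e: "inj_on e {..<k}" and img_e: "e ` {..<k} = A"
    using e by (auto simp: bij_betw_def)
  have inj_f: "inj_on f {w. length w = k}"
  proof (rule inj_onI)
    fix u v assume uv: "u \<in> {w. length w = k}" "v \<in> {w. length w = k}" "f u = f v"
    then have "e ` ones u = e ` ones v"
      using ones_f by (metis mem_Collect_eq)
    then have "ones u = ones v"
      using inj_on_image_eq_iff[OF inj_e, of "ones u" "ones v"] uv by (simp add: ones_subset)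
    then show "u = v"
      using uv by (simp add: ones_inject)
  qed
  have f_surj: "\<exists>w. length w = k \<and> v = f w" if v: "length v = n" "ones v \<subseteq> A" for v
  proof -
    obtain S where S: "S \<subseteq> {..<k}" "ones v = e ` S"
      using v(2) img_e by (metis subset_imageE)
    then have "f (string_of k S) = v"
      using v(1) by (simp add: f_def Int_absorb2 flip: S(2))
    then show ?thesis by (metis length_string_of)
  qed
  have adj: "(\<exists>a. ones (f v) = sym_diff (ones (f u)) {a}) \<longleftrightarrow> (\<exists>a. ones v = sym_diff (ones u) {a})"
    (is "?L \<longleftrightarrow> ?R") if uv: "length u = k" "length v = k" for u v
  proof -
    have "e ` sym_diff (ones u) (ones v) = sym_diff (e ` ones u) (e ` ones v)"
      using inj_on_image_set_diff[OF inj_e, of "ones u" "ones v"]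
        inj_on_image_set_diff[OF inj_e, of "ones v" "ones u"]
        ones_subset[OF uv(1)] ones_subset[OF uv(2)]
      by (simp add: image_Un subset_trans[OF Diff_subset])
    moreover have "card (e ` sym_diff (ones u) (ones v)) = card (sym_diff (ones u) (ones v))"
      by (rule card_image, rule inj_on_subset[OF inj_e])
        (use ones_subset[OF uv(1)] ones_subset[OF uv(2)] in blast)
    moreover have "(\<exists>a. Y = sym_diff X {a}) \<longleftrightarrow> card (sym_diff X Y) = 1" for X Y :: "nat set"
      unfolding card_1_singleton_iff One_nat_def by blast
    ultimately show ?thesis
      using uv by (simp add: ones_f)
  qed
  define h where "h = \<lparr>iso_verts = f, iso_arcs = map_prod f f, iso_head = snd, iso_tail = fst\<rparr>"
  have arcs_subset: "arcs (hypercube k) \<subseteq> {w. length w = k} \<times> {w. length w = k}"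
    by (auto simp: arcs_hypercube)
  have "pre_digraph.digraph_isomorphism (hypercube k) h"
    unfolding pre_digraph.digraph_isomorphism_def
  proof (intro conjI ballI)
    show "wf_digraph (hypercube k)"
      using graph_hypercube by (rule graph.axioms(1)[THEN digraph.axioms(1), THEN fin_digraph.axioms(1)])
    show "inj_on (iso_verts h) (verts (hypercube k))"
      using inj_f by (simp add: h_def)
    show "inj_on (iso_arcs h) (arcs (hypercube k))"
      using inj_on_subset[OF map_prod_inj_on[OF inj_f inj_f] arcs_subset] by (simp add: h_def)
  qed (simp_all add: h_def)
  moreover have "lower_cube p n A = app_iso h (hypercube k)"
  proof (rule pre_digraph.equality)
    show "verts (lower_cube p n A) = verts (app_iso h (hypercube k))"
    proof (rule set_eqI)
      fix v
      have "v \<in> verts (lower_cube p n A) \<longleftrightarrow> (\<exists>w. length w = k \<and> v = f w)"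
      proof
        assume "v \<in> verts (lower_cube p n A)"
        then show "\<exists>w. length w = k \<and> v = f w"
          by (intro f_surj) simp_all
      next
        assume "\<exists>w. length w = k \<and> v = f w"
        then obtain w where "length w = k" "v = f w" by blast
        then show "v \<in> verts (lower_cube p n A)"
          using ones_f_subset by simp
      qed
      then show "v \<in> verts (lower_cube p n A) \<longleftrightarrow> v \<in> verts (app_iso h (hypercube k))"
        by (auto simp: h_def)
    qed
    have "(u, v) \<in> arcs (lower_cube p n A) \<longleftrightarrow> (u, v) \<in> arcs (app_iso h (hypercube k))" for u v
    proof
      assume uv: "(u, v) \<in> arcs (lower_cube p n A)"
      then have "length u = n" "ones u \<subseteq> A" "length v = n" "ones v \<subseteq> A"
        by (auto simp: lower_cube_def)
      then obtain u' v' where "length u' = k" "u = f u'" "length v' = k" "v = f v'"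
        using f_surj by metis
      with uv adj have "(u', v') \<in> arcs (hypercube k)"
        by (auto simp: lower_cube_def arcs_fibonacci_cube arcs_hypercube)
      then show "(u, v) \<in> arcs (app_iso h (hypercube k))"
        using \<open>u = f u'\<close> \<open>v = f v'\<close> by (force simp: h_def)
    next
      assume "(u, v) \<in> arcs (app_iso h (hypercube k))"
      then obtain u' v' where uv: "(u', v') \<in> arcs (hypercube k)" "u = f u'" "v = f v'"
        by (auto simp: h_def)
      then have len: "length u' = k" "length v' = k"
        by (auto simp: arcs_hypercube)
      then have "ones u \<subseteq> A" "ones v \<subseteq> A"
        using uv ones_f_subset by simp_all
      moreover have "\<exists>a. ones v = sym_diff (ones u) {a}"
        using uv len adj by (simp add: arcs_hypercube)
      ultimately show "(u, v) \<in> arcs (lower_cube p n A)"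
        using uv gap gapped_subset by (auto simp: lower_cube_def arcs_fibonacci_cube)
    qed
    then show "arcs (lower_cube p n A) = arcs (app_iso h (hypercube k))"
      by auto
  qed (simp_all add: h_def lower_cube_def)
  ultimately show ?thesis
    unfolding digraph_iso_def k_def by blast
qed

lemma subgraph_of_induced:
  assumes "induced_subgraph H G" "induced_subgraph H' G" "verts H \<subseteq> verts H'"
  shows "subgraph H H'"
  using assms by (auto simp: induced_subgraph_def subgraph_def compatible_def)

text \<open>
  The top \<open>B \<union> D\<close> of the subcube with base point \<open>B\<close> and directions \<open>D\<close> is one of its vertices,
  hence gapped, and all vertices of the subcube lie below it.
\<close>
lemma hypercube_le_lower_cube:
  assumes ind: "induced_subgraph H (fibonacci_cube p n)" and iso: "digraph_iso (hypercube k) H"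
  obtains A where "A \<in> gapped_sets p n" "subgraph H (lower_cube p n A)"
proof -
  have sub: "subgraph H (hypercube n)"
    using ind induced_subgraph_fibonacci_cube
    by (metis induced_imp_subgraph subgraph_trans)
  obtain B D where BD: "B \<subseteq> {..<n}" "D \<subseteq> {..<n}" "ones ` verts H = sym_diff B ` Pow D"
    using hypercube_subgraph_verts[OF iso sub] by metis
  have vH: "verts H \<subseteq> {w. length w = n \<and> gapped p (ones w)}"
    using ind by (auto simp: verts_fibonacci_cube[symmetric] induced_subgraph_def subgraph_def)
  have "B \<union> D = sym_diff B (D - B)"
    by blast
  then have "B \<union> D \<in> ones ` verts H"
    unfolding BD(3) by blast
  then have gap: "gapped p (B \<union> D)"
    using vH by auto
  have "verts H \<subseteq> verts (lower_cube p n (B \<union> D))"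
  proof
    fix w assume w: "w \<in> verts H"
    then have "ones w \<in> sym_diff B ` Pow D"
      using BD(3) by blast
    then show "w \<in> verts (lower_cube p n (B \<union> D))"
      using w vH by auto
  qed
  then have "subgraph H (lower_cube p n (B \<union> D))"
    using subgraph_of_induced ind induced_subgraph_lower_cube[OF gap] by blast
  then show ?thesis
    using that[of "B \<union> D"] gap BD(1,2) by (simp add: gapped_sets_def)
qed

lemma subgraph_lower_cube_iff:
  assumes "A \<in> gapped_sets p n" "A' \<in> gapped_sets p n"
  shows "subgraph (lower_cube p n A) (lower_cube p n A') \<longleftrightarrow> A \<subseteq> A'"
proof
  assume "subgraph (lower_cube p n A) (lower_cube p n A')"
  then have "verts (lower_cube p n A) \<subseteq> verts (lower_cube p n A')"
    by (rule subgraph_imp_subverts)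
  moreover have "string_of n A \<in> verts (lower_cube p n A)"
    by simp
  ultimately have "string_of n A \<in> verts (lower_cube p n A')"
    by blast
  then have "A \<inter> {..<n} \<subseteq> A'"
    by simp
  then show "A \<subseteq> A'"
    using assms by (auto simp: gapped_sets_def)
next
  assume "A \<subseteq> A'"
  then show "subgraph (lower_cube p n A) (lower_cube p n A')"
    using assms by (intro subgraph_of_induced[OF induced_subgraph_lower_cube induced_subgraph_lower_cube])
      (auto simp: gapped_sets_def)
qed

lemma inj_on_lower_cube: "inj_on (lower_cube p n) (gapped_sets p n)"
proof (rule inj_onI)
  fix A A' assume A: "A \<in> gapped_sets p n" "A' \<in> gapped_sets p n"
    and eq: "lower_cube p n A = lower_cube p n A'"
  show "A = A'"
    using subgraph_lower_cube_iff[OF A] subgraph_lower_cube_iff[OF A(2,1)] subgraph_lower_cube_iff[OF A(1,1)] eq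
    by auto
qed

lemma hypercube_dim_unique:
  assumes "digraph_iso (hypercube k) H" "digraph_iso (hypercube m) H"
  shows "k = m"
proof -
  have card: "card (verts H) = 2 ^ k" if iso: "digraph_iso (hypercube k) H" for k
  proof -
    obtain h where "pre_digraph.digraph_isomorphism (hypercube k) h" "H = app_iso h (hypercube k)"
      using iso unfolding digraph_iso_def by blast
    then show ?thesis
      using card_lists_length_eq[of "UNIV :: bool set" k]
      by (simp add: pre_digraph.digraph_isomorphism_def card_image)
  qed
  have "(2 :: nat) ^ k = 2 ^ m"
    using card[OF assms(1)] card[OF assms(2)] by simp
  then show ?thesis by simp
qed

text \<open>
  Every hypercube lies in one reaching down to the zero string, and those are ordered in the
  same way as their tops. So maximal hypercubes correspond to maximal gapped sets.
\<close>
lemma maximal_hypercubes_fibonacci_cube: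
  "{H. maximal_hypercube (fibonacci_cube p n) k H} =
     lower_cube p n ` {A \<in> maximal_gapped_sets p n. card A = k}"
proof (intro equalityI subsetI)
  fix H assume "H \<in> {H. maximal_hypercube (fibonacci_cube p n) k H}"
  then have H: "induced_subgraph H (fibonacci_cube p n)" "digraph_iso (hypercube k) H"
    and max: "\<And>H' m. induced_subgraph H' (fibonacci_cube p n) \<Longrightarrow> digraph_iso (hypercube m) H' \<Longrightarrow>
       subgraph H H' \<Longrightarrow> H = H'"
    unfolding maximal_hypercube_def by blast+
  have lower: "H = lower_cube p n A" if "A \<in> gapped_sets p n" "subgraph H (lower_cube p n A)" for A
    using max[OF induced_subgraph_lower_cube digraph_iso_lower_cube] that
    by (auto simp: gapped_sets_def)
  obtain A where A: "A \<in> gapped_sets p n" "subgraph H (lower_cube p n A)"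
    using hypercube_le_lower_cube[OF H] by blast
  have "A = A'" if A': "A' \<in> gapped_sets p n" "A \<subseteq> A'" for A'
  proof -
    have "subgraph H (lower_cube p n A')"
      using lower[OF A] subgraph_lower_cube_iff[OF A(1) A'(1)] A'(2) by simp
    then have "lower_cube p n A = lower_cube p n A'"
      using lower[OF A] lower[OF A'(1)] by simp
    then show ?thesis
      using inj_on_lower_cube A(1) A'(1) by (auto dest: inj_onD)
  qed
  moreover have "card A = k"
    using hypercube_dim_unique digraph_iso_lower_cube[OF A(1)] H(2) lower[OF A] by blast
  ultimately show "H \<in> lower_cube p n ` {A \<in> maximal_gapped_sets p n. card A = k}"
    using A lower[OF A] by (auto simp: maximal_gapped_sets_def)
next
  fix H assume "H \<in> lower_cube p n ` {A \<in> maximal_gapped_sets p n. card A = k}"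
  then obtain A where A: "A \<in> gapped_sets p n" "card A = k" "H = lower_cube p n A"
    and max: "\<And>A'. A' \<in> gapped_sets p n \<Longrightarrow> A \<subseteq> A' \<Longrightarrow> A = A'"
    by (auto simp: maximal_gapped_sets_def)
  have ind: "induced_subgraph H (fibonacci_cube p n)"
    using A induced_subgraph_lower_cube by (auto simp: gapped_sets_def)
  have "H = H'" if H': "induced_subgraph H' (fibonacci_cube p n)" "digraph_iso (hypercube m) H'"
    "subgraph H H'" for H' m
  proof -
    obtain A' where A': "A' \<in> gapped_sets p n" "subgraph H' (lower_cube p n A')"
      using hypercube_le_lower_cube[OF H'(1,2)] by blast
    then have "subgraph H (lower_cube p n A')"
      using H'(3) subgraph_trans by blast
    then have "A = A'"
      using max[OF A'(1)] subgraph_lower_cube_iff[OF A(1) A'(1)] A(3) by simp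
    then have "verts H = verts H'"
      using A' A(3) H'(3) subgraph_imp_subverts by (metis subset_antisym)
    then show ?thesis
      using induced_eq_verts_imp_eq[OF ind H'(1)] by simp
  qed
  then show "H \<in> {H. maximal_hypercube (fibonacci_cube p n) k H}"
    unfolding maximal_hypercube_def using ind digraph_iso_lower_cube[OF A(1)] A(2,3) by blast
qed

lemma num_maximal_hypercubes_fibonacci_cube:
  "num_maximal_hypercubes (fibonacci_cube p n) k = card {A \<in> maximal_gapped_sets p n. card A = k}"
  unfolding num_maximal_hypercubes_def maximal_hypercubes_fibonacci_cube
  by (rule card_image, rule inj_on_subset[OF inj_on_lower_cube])
    (auto simp: maximal_gapped_sets_def)

lemma finite_maximal_gapped_sets: "finite (maximal_gapped_sets p n)"
  by (rule finite_subset[of _ "Pow {..<n}"])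
    (auto simp: maximal_gapped_sets_def gapped_sets_def)

lemma maximal_hypercube_poly_fibonacci_cube:
  "maximal_hypercube_poly (fibonacci_cube p n) = (\<Sum>A\<in>maximal_gapped_sets p n. [:0, 1:] ^ card A)"
proof -
  let ?M = "maximal_gapped_sets p n" and ?h = "num_maximal_hypercubes (fibonacci_cube p n)"
  have h: "?h k = card {A \<in> ?M. card A = k}" for k
    by (rule num_maximal_hypercubes_fibonacci_cube)
  have nonzero: "?h k \<noteq> 0 \<longleftrightarrow> k \<in> card ` ?M" for k
    unfolding h using finite_maximal_gapped_sets[of p n] by auto
  have "maximal_hypercube_poly (fibonacci_cube p n) = (\<Sum>k\<in>card ` ?M. monom (of_nat (?h k)) k)"
    unfolding maximal_hypercube_poly_def nonzero by simp
  also have "\<dots> = (\<Sum>k\<in>card ` ?M. \<Sum>A | A \<in> ?M \<and> card A = k. [:0, 1:] ^ card A)"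
    by (intro sum.cong refl) (simp add: h monom_altdef of_nat_poly)
  also have "\<dots> = (\<Sum>A\<in>?M. [:0, 1:] ^ card A)"
    by (rule sum.group) (auto simp: finite_maximal_gapped_sets)
  finally show ?thesis .
qed

section \<open>The recurrence\<close>

text \<open>
  Gapped sets are the independent sets of the graph that joins positions at distance at most
  \<open>p\<close>, and an independent set is maximal iff it is dominating. The local condition on the right
  survives the removal of the first 1, unlike a quantification over larger sets.
\<close>
lemma maximal_gapped_sets_iff:
  "A \<in> maximal_gapped_sets p n \<longleftrightarrow>
     A \<in> gapped_sets p n \<and> (\<forall>m<n. \<exists>i\<in>A. m \<le> i + p \<and> i \<le> m + p)"
proof (intro iffI conjI allI impI)
  assume A: "A \<in> maximal_gapped_sets p n"
  then show gap: "A \<in> gapped_sets p n"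
    by (simp add: maximal_gapped_sets_def)
  fix m assume "m < n"
  show "\<exists>i\<in>A. m \<le> i + p \<and> i \<le> m + p"
  proof (rule ccontr)
    assume far: "\<not> (\<exists>i\<in>A. m \<le> i + p \<and> i \<le> m + p)"
    then have "insert m A \<in> gapped_sets p n"
      using gap \<open>m < n\<close> by (fastforce simp: gapped_sets_def gapped_def)
    then have "A = insert m A"
      using A by (auto simp: maximal_gapped_sets_def)
    with far show False
      by (metis insertI1 le_add1)
  qed
next
  assume A: "A \<in> gapped_sets p n \<and> (\<forall>m<n. \<exists>i\<in>A. m \<le> i + p \<and> i \<le> m + p)"
  have "A' \<subseteq> A" if A': "A' \<in> gapped_sets p n" "A \<subseteq> A'" for A'
  proof
    fix m assume m: "m \<in> A'"
    then obtain i where i: "i \<in> A" "m \<le> i + p" "i \<le> m + p"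
      using A A' by (auto simp: gapped_sets_def)
    moreover have "i < m \<Longrightarrow> i + p < m" "m < i \<Longrightarrow> m + p < i"
      using A' i(1) m by (auto simp: gapped_sets_def gapped_def)
    ultimately have "m = i"
      by linarith
    then show "m \<in> A"
      using i(1) by simp
  qed
  then show "A \<in> maximal_gapped_sets p n"
    using A by (auto simp: maximal_gapped_sets_def)
qed

text \<open>
  On strings: put \<open>0\<^sup>a 1 0\<^sup>p\<close> in front.
\<close>
definition prepend_one :: "nat \<Rightarrow> nat \<Rightarrow> nat set \<Rightarrow> nat set" where
  "prepend_one p a A = insert a ((+) (a + p + 1) ` A)"

lemma inj_prepend_one: "inj (prepend_one p a)"
proof (rule injI)
  fix A B assume eq: "prepend_one p a A = prepend_one p a B"
  have "(+) (a + p + 1) ` A = prepend_one p a A - {a}" for A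
    by (auto simp: prepend_one_def)
  then have "(+) (a + p + 1) ` A = (+) (a + p + 1) ` B"
    using eq by simp
  then show "A = B"
    by (rule inj_image_eq_iff[OF inj_on_add, THEN iffD1])
qed

lemma card_prepend_one: "finite A \<Longrightarrow> card (prepend_one p a A) = Suc (card A)"
  unfolding prepend_one_def
  by (subst card_insert_disjoint) (auto simp: card_image[OF inj_on_add] simp del: add_Suc_right)

lemma prepend_one_eq_imp_eq: "prepend_one p a A = prepend_one p b B \<Longrightarrow> a = b"
proof (rule ccontr)
  assume eq: "prepend_one p a A = prepend_one p b B" and "a \<noteq> b"
  have "a \<in> prepend_one p a A" "b \<in> prepend_one p b B"
    by (simp_all add: prepend_one_def)
  then have "a \<in> (+) (b + p + 1) ` B" "b \<in> (+) (a + p + 1) ` A"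
    using eq \<open>a \<noteq> b\<close> by (auto simp: prepend_one_def)
  then show False by auto
qed

text \<open>
  The new 1 dominates exactly the prefix \<open>0\<^sup>a 1 0\<^sup>p\<close>, because \<open>a \<le> p\<close>, and the positions behind it
  are dominated as before. If \<open>n \<le> a + p\<close>, the prefix overruns the end of the string; truncated
  subtraction then gives \<open>n - (a + p + 1) = 0\<close> and only \<open>A = {}\<close>, as it should be.
\<close>
lemma prepend_one_maximal:
  assumes "a < n" "a \<le> p" and A: "A \<in> maximal_gapped_sets p (n - (a + p + 1))"
  shows "prepend_one p a A \<in> maximal_gapped_sets p n"
  unfolding maximal_gapped_sets_iff
proof (intro conjI allI impI)
  have A_sub: "A \<subseteq> {..<n - (a + p + 1)}" and A_gap: "gapped p A"
    using A by (auto simp: maximal_gapped_sets_iff gapped_sets_def)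
  have "gapped p (prepend_one p a A)"
    using A_gap by (auto simp: gapped_def prepend_one_def add.commute[of p])
  then show "prepend_one p a A \<in> gapped_sets p n"
    using A_sub \<open>a < n\<close> by (force simp: gapped_sets_def prepend_one_def)
  fix m assume "m < n"
  show "\<exists>i\<in>prepend_one p a A. m \<le> i + p \<and> i \<le> m + p"
  proof (cases "m \<le> a + p")
    case True
    then show ?thesis
      using \<open>a \<le> p\<close> by (auto simp: prepend_one_def)
  next
    case False
    then have "m - (a + p + 1) < n - (a + p + 1)"
      using \<open>m < n\<close> by simp
    then obtain i where i: "i \<in> A" "m - (a + p + 1) \<le> i + p" "i \<le> m - (a + p + 1) + p"
      using A unfolding maximal_gapped_sets_iff by blast
    have "a + p + 1 + i \<in> prepend_one p a A"
      using i(1) by (simp add: prepend_one_def)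
    moreover have "m \<le> (a + p + 1 + i) + p" "a + p + 1 + i \<le> m + p"
      using i False by linarith+
    ultimately show ?thesis by blast
  qed
qed

text \<open>
  Position 0 must be dominated, so the least element is at most \<open>p\<close>.
\<close>
lemma maximal_gapped_sets_decompose:
  assumes "n \<ge> 1" and A: "A \<in> maximal_gapped_sets p n"
  obtains a A' where "a < n" "a \<le> p" "A' \<in> maximal_gapped_sets p (n - (a + p + 1))"
    "A = prepend_one p a A'"
proof -
  have A_sub: "A \<subseteq> {..<n}" and A_gap: "\<And>i j. i \<in> A \<Longrightarrow> j \<in> A \<Longrightarrow> i < j \<Longrightarrow> i + p < j"
    and near: "\<And>m. m < n \<Longrightarrow> \<exists>i\<in>A. m \<le> i + p \<and> i \<le> m + p"
    using A by (auto simp: maximal_gapped_sets_iff gapped_sets_def gapped_def)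
  obtain i where i: "i \<in> A" "i \<le> p"
    using near[of 0] \<open>n \<ge> 1\<close> by auto
  define a where "a = (LEAST i. i \<in> A)"
  have a: "a \<in> A" and least: "\<And>j. j \<in> A \<Longrightarrow> a \<le> j"
    unfolding a_def using i(1) by (auto intro: LeastI Least_le)
  have rest: "a + p + 1 \<le> j" if "j \<in> A" "j \<noteq> a" for j
    using A_gap[OF a that(1)] least[OF that(1)] that(2) by linarith
  define A' where "A' = {j. a + p + 1 + j \<in> A}"
  have A_eq: "A = prepend_one p a A'"
  proof (intro equalityI subsetI)
    fix j assume j: "j \<in> A"
    show "j \<in> prepend_one p a A'"
    proof (cases "j = a")
      case False
      then have "j = a + p + 1 + (j - (a + p + 1))"
        using rest[OF j] by simp
      then show ?thesis
        using j unfolding prepend_one_def A'_def by (metis imageI insertI2 mem_Collect_eq)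
    qed (simp add: prepend_one_def)
  qed (use a in \<open>auto simp: prepend_one_def A'_def\<close>)
  have "A' \<subseteq> {..<n - (a + p + 1)}"
  proof
    fix j assume "j \<in> A'"
    then have "a + p + 1 + j < n"
      using A_sub by (auto simp: A'_def)
    then show "j \<in> {..<n - (a + p + 1)}"
      by simp
  qed
  moreover have "gapped p A'"
    unfolding gapped_def
  proof (intro ballI impI)
    fix i j assume "i \<in> A'" "j \<in> A'" "i < j"
    then show "i + p < j"
      using A_gap[of "a + p + 1 + i" "a + p + 1 + j"] by (simp add: A'_def)
  qed
  moreover have "\<exists>i\<in>A'. m \<le> i + p \<and> i \<le> m + p" if "m < n - (a + p + 1)" for m
  proof -
    have "a + p + 1 + m < n"
      using that by simp
    then obtain j where j: "j \<in> A" "a + p + 1 + m \<le> j + p" "j \<le> a + p + 1 + m + p"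
      using near by blast
    then have "a + p + 1 \<le> j"
      using rest by force
    then have "j - (a + p + 1) \<in> A'"
      using j(1) by (simp add: A'_def)
    moreover have "m \<le> j - (a + p + 1) + p" "j - (a + p + 1) \<le> m + p"
      using j \<open>a + p + 1 \<le> j\<close> by linarith+
    ultimately show ?thesis by blast
  qed
  ultimately have "A' \<in> maximal_gapped_sets p (n - (a + p + 1))"
    by (auto simp: maximal_gapped_sets_iff gapped_sets_def)
  moreover have "a < n" "a \<le> p"
    using a A_sub least[OF i(1)] i(2) by auto
  ultimately show ?thesis
    using that A_eq by blast
qed

lemma maximal_hypercube_poly_fibonacci_cube_0:
  "maximal_hypercube_poly (fibonacci_cube p 0) = 1"
proof -
  have "maximal_gapped_sets p 0 = {{}}"
    by (auto simp: maximal_gapped_sets_iff gapped_sets_def gapped_def)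
  then show ?thesis
    by (simp add: maximal_hypercube_poly_fibonacci_cube)
qed

text \<open>
  The summand for \<open>a\<close> counts the maximal gapped sets with least element \<open>a\<close>. Because of the
  truncated subtraction, this single recurrence covers all \<open>n \<ge> 1\<close>.
\<close>
lemma maximal_hypercube_poly_fibonacci_cube_rec:
  assumes "n \<ge> 1"
  shows "maximal_hypercube_poly (fibonacci_cube p n) =
    [:0, 1:] * (\<Sum>a | a < n \<and> a \<le> p. maximal_hypercube_poly (fibonacci_cube p (n - (a + p + 1))))"
proof -
  let ?I = "{a. a < n \<and> a \<le> p}" and ?M = "\<lambda>a. maximal_gapped_sets p (n - (a + p + 1))"
  have union: "maximal_gapped_sets p n = (\<Union>a\<in>?I. prepend_one p a ` ?M a)"
  proof (intro equalityI subsetI)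
    fix A assume "A \<in> maximal_gapped_sets p n"
    then obtain a A' where "a \<in> ?I" "A' \<in> ?M a" "A = prepend_one p a A'"
      using maximal_gapped_sets_decompose[OF assms] by (metis mem_Collect_eq)
    then show "A \<in> (\<Union>a\<in>?I. prepend_one p a ` ?M a)"
      by blast
  qed (auto intro: prepend_one_maximal)
  have finite: "finite A" if "A \<in> ?M a" for A a
    using that by (auto simp: maximal_gapped_sets_def gapped_sets_def intro: finite_subset)
  have "(\<Sum>A\<in>maximal_gapped_sets p n. [:0, 1:] ^ card A) =
      (\<Sum>a\<in>?I. \<Sum>A\<in>prepend_one p a ` ?M a. [:0, 1 :: rat:] ^ card A)"
    unfolding union using prepend_one_eq_imp_eq
    by (intro sum.UNION_disjoint) (auto simp: finite_maximal_gapped_sets)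
  also have "\<dots> = (\<Sum>a\<in>?I. \<Sum>A\<in>?M a. [:0, 1:] ^ card (prepend_one p a A))"
    by (simp add: sum.reindex[OF inj_on_subset[OF inj_prepend_one subset_UNIV]])
  also have "\<dots> = (\<Sum>a\<in>?I. \<Sum>A\<in>?M a. [:0, 1:] * [:0, 1:] ^ card A)"
    by (intro sum.cong refl) (simp only: card_prepend_one[OF finite] power_Suc)
  finally show ?thesis
    by (simp only: maximal_hypercube_poly_fibonacci_cube sum_distrib_left)
qed

section \<open>Closed forms and generating function\<close>

lemma sum_of_nat_diff_lessThan: "(\<Sum>a<m. of_nat (m - a) :: rat) = of_nat m * (of_nat m + 1) / 2"
proof (induction m)
  case (Suc m)
  have "(\<Sum>a<Suc m. of_nat (Suc m - a) :: rat) = of_nat (Suc m) + (\<Sum>a<m. of_nat (m - a))"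
    by (subst sum.lessThan_Suc_shift) simp
  with Suc show ?case by (simp add: field_simps)
qed simp

lemma fps_sum_power_nth: "fps_nth (\<Sum>j\<le>q. fps_X ^ j) i = (if i \<le> q then 1 else (0 :: 'a :: comm_ring_1))"
  by (simp add: fps_sum_nth fps_X_power_nth)

lemma fps_X_power_mult_sum:
  "fps_X ^ m * (\<Sum>i\<le>p. fps_X ^ i) * F = (\<Sum>i\<le>p. fps_X ^ (i + m) * (F :: 'a :: comm_ring_1 fps))"
  by (simp add: sum_distrib_left sum_distrib_right power_add ac_simps)

text \<open>
  Multiplying by the denominator subtracts from \<open>H n\<close> those terms of the recurrence whose
  argument is not truncated, that is \<open>a + p + 1 \<le> n\<close>. The other terms, with \<open>a < n < a + p + 1\<close>,
  are all \<open>H 0 = 1\<close>, and their number is the coefficient of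
  \<open>t (1 + \<dots> + t\<^sup>p) (1 + \<dots> + t\<^sup>p\<^sup>-\<^sup>1)\<close> at \<open>t\<^sup>n\<close>.
\<close>
lemma fps_eq_of_recurrence:
  fixes H :: "nat \<Rightarrow> 'a :: field"
  assumes "p \<ge> 1" and H0: "H 0 = 1"
    and rec: "\<And>n. n \<ge> 1 \<Longrightarrow> H n = c * (\<Sum>a | a < n \<and> a \<le> p. H (n - (a + p + 1)))"
  shows "Abs_fps H =
    (1 + fps_const c * fps_X * (\<Sum>j\<le>p. fps_X ^ j) * (\<Sum>j\<le>p - 1. fps_X ^ j)) /
    (1 - fps_const c * fps_X ^ (p + 1) * (\<Sum>j\<le>p. fps_X ^ j))" (is "_ = ?N / ?D")
proof -
  let ?F = "Abs_fps H"
  have "fps_nth (?F * ?D) n = fps_nth ?N n" for n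
  proof -
    have "?F * ?D = ?F - fps_const c * (fps_X ^ (p + 1) * (\<Sum>j\<le>p. fps_X ^ j) * ?F)"
      by (simp only: right_diff_distrib mult.commute mult.left_commute mult_1_right mult_1_left)
    then have "?F * ?D = ?F - fps_const c * (\<Sum>j\<le>p. fps_X ^ (j + (p + 1)) * ?F)"
      by (simp only: fps_X_power_mult_sum)
    then have D: "fps_nth (?F * ?D) n =
        H n - c * (\<Sum>j\<le>p. if j + p + 1 \<le> n then H (n - (j + p + 1)) else 0)"
      by (simp add: fps_sum_nth fps_X_power_mult_nth del: power_Suc)
        (intro disjI2 sum.cong; auto)
    have "?N = 1 + fps_const c * (\<Sum>i\<le>p. fps_X ^ (i + 1) * (\<Sum>j\<le>p - 1. fps_X ^ j))"
      by (simp only: fps_X_power_mult_sum[symmetric] power_one_right mult.assoc)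
    then have "fps_nth ?N n = fps_nth (1 + fps_const c *
        (\<Sum>i\<le>p. fps_X ^ (i + 1) * (\<Sum>j\<le>p - 1. fps_X ^ j))) n"
      by (rule arg_cong)
    also have "\<dots> = (if n = 0 then 1 else 0) +
        c * (\<Sum>i\<le>p. fps_nth (fps_X ^ (i + 1) * (\<Sum>j\<le>p - 1. fps_X ^ j)) n)"
      by (simp only: fps_add_nth fps_one_nth fps_mult_left_const_nth fps_sum_nth)
    also have "(\<Sum>i\<le>p. fps_nth (fps_X ^ (i + 1) * (\<Sum>j\<le>p - 1. fps_X ^ j)) n) =
        (\<Sum>i\<le>p. if i < n \<and> n < i + p + 1 then 1 else (0 :: 'a))"
      using \<open>p \<ge> 1\<close> by (intro sum.cong refl, unfold fps_X_power_mult_nth fps_sum_power_nth) auto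
    finally have N: "fps_nth ?N n =
        (if n = 0 then 1 else 0) + c * (\<Sum>i\<le>p. if i < n \<and> n < i + p + 1 then 1 else 0)" .
    show ?thesis
    proof (cases "n = 0")
      case True
      then show ?thesis
        unfolding D N by (simp add: H0)
    next
      case False
      have "(\<Sum>a | a < n \<and> a \<le> p. H (n - (a + p + 1))) =
          (\<Sum>a\<le>p. if a < n then H (n - (a + p + 1)) else 0)"
        by (rule sum.mono_neutral_cong_left) auto
      also have "\<dots> = (\<Sum>a\<le>p. (if a + p + 1 \<le> n then H (n - (a + p + 1)) else 0)
          + (if a < n \<and> n < a + p + 1 then 1 else 0))"
        by (intro sum.cong refl) (auto simp: H0)
      finally have "H n = c * (\<Sum>a\<le>p. (if a + p + 1 \<le> n then H (n - (a + p + 1)) else 0)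
          + (if a < n \<and> n < a + p + 1 then 1 else 0))"
        using rec[of n] False by simp
      then show ?thesis
        unfolding D N using False by (simp add: sum.distrib distrib_left)
    qed
  qed
  then have "?F * ?D = ?N"
    by (rule fps_ext)
  moreover have "?D \<noteq> 0"
  proof
    assume "?D = 0"
    then have "fps_nth ?D 0 = 0" by simp
    then show False by simp
  qed
  ultimately show ?thesis
    by (metis nonzero_mult_div_cancel_right)
qed

theorem corollary7p3:
  fixes p :: nat and H :: "nat \<Rightarrow> rat poly" and x :: "rat poly"
    and t xt :: "rat poly fract fps"
  assumes "p \<ge> 1"
  defines "H \<equiv> \<lambda>n. maximal_hypercube_poly (fibonacci_cube p n)"
    and "x \<equiv> [:0, 1:]"
    and "t \<equiv> fps_X"
    and "xt \<equiv> fps_const (to_fract x) * t"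
  shows "(\<forall>n \<ge> 2 * p + 1. H n = x * (\<Sum>i = 1..p + 1. H (n - p - i))) \<and>
    H 0 = 1 \<and>
    (\<forall>n. 1 \<le> n \<and> n \<le> p + 1 \<longrightarrow> H n = of_nat n * x) \<and>
    (\<forall>n. p + 2 \<le> n \<and> n \<le> 2 * p \<longrightarrow>
       H n = smult ((of_nat n - of_nat p - 1) * (of_nat n - of_nat p) / 2) (x ^ 2)
             + smult (2 * of_nat p - of_nat n + 2) x) \<and>
    Abs_fps (\<lambda>n. to_fract (H n)) =
      (1 + xt * (\<Sum>j\<le>p. t ^ j) * (\<Sum>j\<le>p - 1. t ^ j)) /
      (1 - fps_const (to_fract x) * t ^ (p + 1) * (\<Sum>j\<le>p. t ^ j))"
proof -
  have H0: "H 0 = 1"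
    unfolding H_def by (rule maximal_hypercube_poly_fibonacci_cube_0)
  have rec: "H n = x * (\<Sum>a | a < n \<and> a \<le> p. H (n - (a + p + 1)))" if "n \<ge> 1" for n
    unfolding H_def x_def using that by (rule maximal_hypercube_poly_fibonacci_cube_rec)
  have large: "H n = x * (\<Sum>i = 1..p + 1. H (n - p - i))" if "n \<ge> 2 * p + 1" for n
  proof -
    have "(\<Sum>i = 1..p + 1. H (n - p - i)) = (\<Sum>a | a < n \<and> a \<le> p. H (n - (a + p + 1)))"
      by (rule sum.reindex_bij_witness[of _ Suc "\<lambda>i. i - 1"]) (use that in \<open>auto simp: add.commute\<close>)
    then show ?thesis
      using rec[of n] that by simp
  qed
  have small: "H n = of_nat n * x" if "1 \<le> n" "n \<le> p + 1" for n
  proof -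
    have "(\<Sum>a | a < n \<and> a \<le> p. H (n - (a + p + 1))) = (\<Sum>a<n. 1)"
      by (rule sum.cong) (use that H0 in auto)
    then show ?thesis
      using rec[of n] that by (simp add: mult.commute)
  qed
  have medium: "H n = smult ((of_nat n - of_nat p - 1) * (of_nat n - of_nat p) / 2) (x ^ 2)
             + smult (2 * of_nat p - of_nat n + 2) x" if n: "p + 2 \<le> n" "n \<le> 2 * p" for n
  proof -
    \<comment> \<open>For \<open>a < m\<close> the argument \<open>n - (a + p + 1) = m - a\<close> lies in the range of the linear formula;
      for \<open>a \<ge> m\<close> it is 0.\<close>
    define m where "m = n - (p + 1)"
    have m: "n = m + p + 1" "m \<le> p"
      using n by (auto simp: m_def)
    have "{a. a < n \<and> a \<le> p} = {..<m} \<union> {m..p}"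
      using m by auto
    then have "(\<Sum>a | a < n \<and> a \<le> p. H (n - (a + p + 1))) =
        (\<Sum>a<m. H (m - a)) + (\<Sum>a = m..p. H (m - a))"
      using m by (simp add: sum.union_disjoint ivl_disj_int)
    also have "(\<Sum>a<m. H (m - a)) = (\<Sum>a<m. of_nat (m - a) * x)"
      by (intro sum.cong refl small) (use m in auto)
    also have "\<dots> = smult (\<Sum>a<m. of_nat (m - a)) x"
      by (simp add: smult_sum of_nat_poly)
    also have "(\<Sum>a = m..p. H (m - a)) = (\<Sum>a = m..p. 1)"
      by (intro sum.cong) (auto simp: H0)
    also have "\<dots> = [:of_nat p + 1 - of_nat m:]"
      using m by (simp add: of_nat_poly of_nat_diff)
    finally have "H n = x * (smult (of_nat m * (of_nat m + 1) / 2) x + [:of_nat p + 1 - of_nat m:])"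
      using rec[of n] n unfolding sum_of_nat_diff_lessThan by simp
    then show ?thesis
      unfolding m(1) by (simp add: distrib_left power2_eq_square algebra_simps)
  qed
  have "to_fract (\<Sum>a\<in>I. f a) = (\<Sum>a\<in>I. to_fract (f a))" for f :: "nat \<Rightarrow> rat poly" and I
    by (induction I rule: infinite_finite_induct) simp_all
  then have "to_fract (H n) = to_fract x * (\<Sum>a | a < n \<and> a \<le> p. to_fract (H (n - (a + p + 1))))"
    if "n \<ge> 1" for n
    using rec[OF that] by simp
  then have "Abs_fps (\<lambda>n. to_fract (H n)) =
      (1 + xt * (\<Sum>j\<le>p. t ^ j) * (\<Sum>j\<le>p - 1. t ^ j)) /
      (1 - fps_const (to_fract x) * t ^ (p + 1) * (\<Sum>j\<le>p. t ^ j))"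
    unfolding xt_def t_def using assms(1) by (intro fps_eq_of_recurrence) (simp_all add: H0)
  then show ?thesis
    using H0 large small medium by blast
qed

end
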